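(* Let $n\ge 3$ and let $C_n$ be the cycle graph with $n$ edges $e_1,\dots,e_n$, ordered by $e_1<\cdots<e_n$. Let $\Bbbk$ be a field and write $x_i$ for the variable corresponding to $e_i$. Then $$I_{\mathrm{BC}(C_n)}=(x_1x_2\cdots x_{n-1}),\qquad \Bbbk[\mathrm{BC}(C_n)]=\frac{\Bbbk[x_1,\ldots,x_n]}{(x_1\cdots x_{n-1})},$$ and $$h_{C_n}(z)=1+z+\cdots+z^{n-2},\qquad \mathrm{Hilb}(\Bbbk[\mathrm{BC}(C_n)];z)=\frac{1+z+\cdots+z^{n-2}}{(1-z)^{n-1}}.$$
   Context: For a finite connected loopless graph $G$ with a fixed total order on $E(G)$, a broken circuit is a set $C\setminus\{\max C\}$, where $C$ is the edge set of a cycle of $G$ and $\max C$ is its largest edge. The broken-circuit complex $\mathrm{BC}(G)$ is the simplicial complex on $E(G)$ whose faces are the edge sets containing no broken circuit. Its Stanley--Reisner ring is $\Bbbk[\mathrm{BC}(G)]=\Bbbk[x_e:e\in E(G)]/I_{\mathrm{BC}(G)}$, with $I_{\mathrm{BC}(G)}$ generated by the monomials $\prod_{e\in C\setminus\{\max C\}}x_e$ over all cycles $C$ of $G$; it is graded by $\deg x_e=1$, and $\mathrm{Hilb}$ denotes its Hilbert series. With $r=|V(G)|-1$ and $b_i$ the number of faces of $\mathrm{BC}(G)$ having exactly $i$ elements, the $h$-polynomial of $\mathrm{BC}(G)$ is $h_G(z)=\sum_{i=0}^{r}b_i z^i(1-z)^{r-i}$. *)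

theory Defs
  imports
    "HOL-Library.Poly_Mapping"
    "HOL-Computational_Algebra.Polynomial"
    "HOL-Computational_Algebra.Formal_Power_Series"
    "HOL-Algebra.QuotRing"
    "HOL-Algebra.Embedded_Algebras"
begin

section \<open>Graphs and cycles\<close>

text \<open>Undirected graphs, possibly with parallel edges; the total order on the edge set is the
  order of the edge type.\<close>

record ('v, 'e) multigraph =
  vertices :: "'v set"
  edges :: "'e set"
  ends :: "'e \<Rightarrow> 'v set"

definition fin_conn_loopless_graph :: "('v, 'e) multigraph \<Rightarrow> bool" where
  "fin_conn_loopless_graph G \<longleftrightarrow>
     finite (vertices G) \<and> vertices G \<noteq> {} \<and> finite (edges G) \<and>
     (\<forall>a\<in>edges G. ends G a \<subseteq> vertices G \<and> card (ends G a) = 2) \<and>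
     (\<forall>x\<in>vertices G. \<forall>y\<in>vertices G. (x, y) \<in> {(u, w). \<exists>a\<in>edges G. ends G a = {u, w}}\<^sup>*)"

text \<open>The cycle of length \<open>k\<close> with vertices \<open>v 0, \<dots>, v (k - 1)\<close> and edges \<open>f 0, \<dots>, f (k - 1)\<close>.
  Length 2 (a pair of parallel edges) is allowed; length 1 would be a loop.\<close>

definition is_cycle :: "('v, 'e) multigraph \<Rightarrow> nat \<Rightarrow> (nat \<Rightarrow> 'v) \<Rightarrow> (nat \<Rightarrow> 'e) \<Rightarrow> bool" where
  "is_cycle G k v f \<longleftrightarrow>
     2 \<le> k \<and> inj_on v {..<k} \<and> inj_on f {..<k} \<and>
     v ` {..<k} \<subseteq> vertices G \<and> f ` {..<k} \<subseteq> edges G \<and>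
     (\<forall>i<k. ends G (f i) = {v i, v (Suc i mod k)})"

definition cycle_edge_sets :: "('v, 'e) multigraph \<Rightarrow> 'e set set" where
  "cycle_edge_sets G = {f ` {..<k} |k v f. is_cycle G k v f}"

definition is_cycle_graph :: "nat \<Rightarrow> ('v, 'e) multigraph \<Rightarrow> bool" where
  "is_cycle_graph n G \<longleftrightarrow>
     (\<exists>v f. is_cycle G n v f \<and> vertices G = v ` {..<n} \<and> edges G = f ` {..<n})"

lemma is_cycle_graph_fin_conn_loopless:
  assumes "is_cycle_graph n G"
  shows "fin_conn_loopless_graph G"
proof -
  from assms obtain v f where c: "is_cycle G n v f"
    and V: "vertices G = v ` {..<n}" and E: "edges G = f ` {..<n}"
    unfolding is_cycle_graph_def by blast
  let ?R = "{(u, w). \<exists>a\<in>edges G. ends G a = {u, w}}"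
  have n: "2 \<le> n" and inj: "inj_on v {..<n}"
    using c by (auto simp: is_cycle_def)
  have en: "ends G (f i) = {v i, v (Suc i mod n)}" if "i < n" for i
    using c that by (auto simp: is_cycle_def)
  have ends: "ends G a \<subseteq> vertices G \<and> card (ends G a) = 2" if a: "a \<in> edges G" for a
  proof -
    obtain i where i: "i < n" "a = f i" using a E by auto
    have "Suc i mod n \<noteq> i"
      using i(1) n by (cases "Suc i = n") auto
    moreover have "Suc i mod n < n" using n by simp
    ultimately have "v i \<noteq> v (Suc i mod n)"
      using inj i(1) by (metis inj_on_eq_iff lessThan_iff)
    with en[OF i(1)] show ?thesis using i V \<open>Suc i mod n < n\<close> by auto
  qed
  have sym: "sym (?R\<^sup>*)"
    by (rule sym_rtrancl) (simp add: sym_def insert_commute)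
  have reach: "(v 0, v i) \<in> ?R\<^sup>*" if "i < n" for i
    using that
  proof (induction i)
    case (Suc i)
    then have "ends G (f i) = {v i, v (Suc i)}" using en[of i] by simp
    then have "(v i, v (Suc i)) \<in> ?R" using Suc.prems E by auto
    with Suc show ?case by (simp add: rtrancl.rtrancl_into_rtrancl)
  qed simp
  have "(x, y) \<in> ?R\<^sup>*" if xy: "x \<in> vertices G" "y \<in> vertices G" for x y
  proof -
    obtain i j where "i < n" "x = v i" "j < n" "y = v j" using xy V by auto
    then have "(v 0, y) \<in> ?R\<^sup>*" "(x, v 0) \<in> ?R\<^sup>*" using reach symD[OF sym] by simp_all
    then show ?thesis by (rule rtrancl_trans[rotated])
  qed
  moreover have "v 0 \<in> vertices G" "finite (vertices G)" "finite (edges G)"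
    using V E n by simp_all
  ultimately show ?thesis
    unfolding fin_conn_loopless_graph_def using ends by (intro conjI ballI) auto
qed

lemma is_cycle_graph_concrete:
  assumes "2 \<le> n"
  shows "is_cycle_graph n
    \<lparr>vertices = {..<n}, edges = {1..n}, ends = (\<lambda>i. {i - 1, i mod n})\<rparr>"
proof -
  have "Suc ` {..<n} = {1..n}"
    by (simp only: image_Suc_lessThan)
  then show ?thesis
    unfolding is_cycle_graph_def is_cycle_def using assms
    by (intro exI[of _ "\<lambda>i. i"] exI[of _ Suc]) auto
qed

section \<open>The broken-circuit complex\<close>

definition broken_circuits :: "('v, 'e::linorder) multigraph \<Rightarrow> 'e set set" where
  "broken_circuits G = {C - {Max C} |C. C \<in> cycle_edge_sets G}"

definition bc_complex :: "('v, 'e::linorder) multigraph \<Rightarrow> 'e set set" where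
  "bc_complex G = {F. F \<subseteq> edges G \<and> (\<forall>B\<in>broken_circuits G. \<not> B \<subseteq> F)}"

definition face_count :: "('v, 'e::linorder) multigraph \<Rightarrow> nat \<Rightarrow> nat" where
  "face_count G i = card {F \<in> bc_complex G. card F = i}"

definition h_poly :: "('v, 'e::linorder) multigraph \<Rightarrow> int poly" where
  "h_poly G = (let r = card (vertices G) - 1 in
     \<Sum>i=0..r. of_nat (face_count G i) * [:0, 1:] ^ i * (1 - [:0, 1:]) ^ (r - i))"

section \<open>Polynomial rings and the Stanley--Reisner ring\<close>

text \<open>A polynomial maps finitely many exponent vectors to nonzero coefficients; the product of
  \<^theory>\<open>HOL-Library.Poly_Mapping\<close> is the convolution.\<close>

type_synonym ('e, 'k) mpoly = "('e \<Rightarrow>\<^sub>0 nat) \<Rightarrow>\<^sub>0 'k"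

definition Const :: "'k::field \<Rightarrow> ('e, 'k) mpoly" where
  "Const c = Poly_Mapping.single 0 c"

definition Var :: "'e \<Rightarrow> ('e, 'k::field) mpoly" where
  "Var a = Poly_Mapping.single (Poly_Mapping.single a 1) 1"

definition poly_ring :: "'e set \<Rightarrow> ('e, 'k::field) mpoly ring" where
  "poly_ring E =
     \<lparr>carrier = {p. \<forall>m\<in>Poly_Mapping.keys p. Poly_Mapping.keys m \<subseteq> E},
      mult = (*), one = 1, zero = 0, add = (+)\<rparr>"

lemma poly_ring_cring: "cring (poly_ring E :: ('e, 'k::field) mpoly ring)"
proof -
  define P where
    "P = {p :: ('e, 'k) mpoly. \<forall>m\<in>Poly_Mapping.keys p. Poly_Mapping.keys m \<subseteq> E}"
  have uminus: "- p \<in> P" if "p \<in> P" for p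
    using that by (simp add: P_def)
  have zero_one: "0 \<in> P" "1 \<in> P"
    by (simp_all add: P_def)
  have add: "p + q \<in> P" if "p \<in> P" "q \<in> P" for p q
    using that Poly_Mapping.keys_add[of p q] by (auto simp: P_def)
  have mult: "p * q \<in> P" if pq: "p \<in> P" "q \<in> P" for p q
    unfolding P_def
  proof (clarify)
    fix m x assume m: "m \<in> Poly_Mapping.keys (p * q)" and x: "x \<in> Poly_Mapping.keys m"
    obtain a b where "m = a + b" "a \<in> Poly_Mapping.keys p" "b \<in> Poly_Mapping.keys q"
      using m keys_mult[of p q] by blast
    then show "x \<in> E" using x pq Poly_Mapping.keys_add[of a b] unfolding P_def by blast
  qed
  have neg: "\<exists>q\<in>P. p + q = 0" if "p \<in> P" for p
    using uminus[OF that] by (intro bexI[of _ "- p"]) simp_all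
  show ?thesis
    unfolding poly_ring_def P_def[symmetric]
    by (intro cringI abelian_groupI comm_monoidI)
      (simp_all add: zero_one add mult neg add.assoc add.commute mult.assoc mult.commute distrib_left)
qed

definition hom_polys :: "'e set \<Rightarrow> nat \<Rightarrow> ('e, 'k::field) mpoly set" where
  "hom_polys E d = {p \<in> carrier (poly_ring E).
     \<forall>m\<in>Poly_Mapping.keys p. (\<Sum>a\<in>Poly_Mapping.keys m. Poly_Mapping.lookup m a) = d}"

definition bc_ideal :: "('v, 'e::linorder) multigraph \<Rightarrow> ('e, 'k::field) mpoly set" where
  "bc_ideal G = Idl\<^bsub>poly_ring (edges G)\<^esub> {(\<Prod>a\<in>B. Var a) |B. B \<in> broken_circuits G}"

definition bc_ring :: "('v, 'e::linorder) multigraph \<Rightarrow> ('e, 'k::field) mpoly set ring" where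
  "bc_ring G = poly_ring (edges G) Quot bc_ideal G"

text \<open>The residue map onto \<open>bc_ring G\<close>; through it \<open>bc_ring G\<close> receives the scalars and the
  grading.\<close>

definition bc_residue ::
    "('v, 'e::linorder) multigraph \<Rightarrow> ('e, 'k::field) mpoly \<Rightarrow> ('e, 'k) mpoly set" where
  "bc_residue G p = bc_ideal G +>\<^bsub>poly_ring (edges G)\<^esub> p"

definition bc_scalars :: "('v, 'e::linorder) multigraph \<Rightarrow> ('e, 'k::field) mpoly set set" where
  "bc_scalars G = bc_residue G ` range Const"

definition bc_component ::
    "('v, 'e::linorder) multigraph \<Rightarrow> nat \<Rightarrow> ('e, 'k::field) mpoly set set" where
  "bc_component G d = bc_residue G ` hom_polys (edges G) d"

text \<open>The Hilbert series of a graded \<open>K\<close>-algebra \<open>A\<close> with homogeneous components \<open>A\<^sub>d = gr d\<close>,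
  where \<open>K\<close> is a subfield of the ring \<open>A\<close>. Rational coefficients make division by
  \<open>(1 - z) ^ m\<close> available.\<close>

definition hilbert_series ::
    "('a, 'b) ring_scheme \<Rightarrow> 'a set \<Rightarrow> (nat \<Rightarrow> 'a set) \<Rightarrow> rat fps" where
  "hilbert_series A K gr = Abs_fps (\<lambda>d. of_nat (ring.dim A K (gr d)))"

end

theory Submission
  imports Defs
begin

text \<open>The only cycle of \<open>C\<^sub>n\<close> is the whole graph, since a cycle entering a vertex of degree 2
  must leave it through the other edge. So the only broken circuit is \<open>A = {e\<^sub>1, \<dots>, e\<^sub>n} - {e\<^sub>n}\<close>.
  The faces of the complex are the edge sets other than \<open>A\<close> with at most \<open>n - 1\<close> elements, and
  the binomial theorem gives \<open>(1 - z) h(z) = 1 - z ^ (n - 1)\<close>. The monomials not divisible by the generator \<open>x ^ \<mu>\<close> of the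
  ideal form a basis of the quotient. As multiplication by \<open>x ^ \<mu>\<close> is injective, their generating
  function is \<open>1 - z ^ deg \<mu>\<close> times that of all monomials; with a single variable for \<open>x ^ \<mu>\<close>, the same
  relation gives \<open>1 / (1 - z) ^ n\<close> for the latter by induction on the number of variables.\<close>

section \<open>The broken-circuit complex of a cycle graph\<close>

text \<open>Every vertex of a cycle lies on two of its edges: an end of \<open>f j\<close> is shared
  either with the next edge or with the previous one. In length 2 both of these are the parallel
  edge.\<close>

lemma cycle_edge_adjacent:
  assumes c: "is_cycle G k v f" and d: "d \<in> f ` {..<k}" and x: "x \<in> ends G d"
  obtains d' where "d' \<in> f ` {..<k}" "d' \<noteq> d" "x \<in> ends G d'"
proof -
  have k: "2 \<le> k" and inj: "inj_on f {..<k}"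
    and ends: "\<And>i. i < k \<Longrightarrow> ends G (f i) = {v i, v (Suc i mod k)}"
    using c by (auto simp: is_cycle_def)
  obtain j where j: "j < k" "d = f j" using d by auto
  obtain l where l: "l < k" "l \<noteq> j" "x \<in> ends G (f l)"
  proof (cases "x = v (Suc j mod k)")
    case True
    have "Suc j mod k < k" "Suc j mod k \<noteq> j"
      using j k by (cases "Suc j = k"; auto)+
    with True that[of "Suc j mod k"] ends[of "Suc j mod k"] show thesis by auto
  next
    case False
    then have x: "x = v j" using x j ends by auto
    \<comment> \<open>The cyclic predecessor of \<open>j\<close>; it differs from \<open>j\<close>
      because \<open>k\<close> is at least 2.\<close>
    define l where "l = (if j = 0 then k - 1 else j - 1)"
    have "l < k" "l \<noteq> j" "Suc l mod k = j"
      using j k by (auto simp: l_def)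
    with x that[of l] ends[of l] show thesis by auto
  qed
  then have "f l \<noteq> f j" using inj j by (auto simp: inj_on_def)
  with l j show thesis by (intro that[of "f l"]) auto
qed

text \<open>The edge set of a cycle in \<open>G\<close> is closed under passing from an edge of
  \<open>G\<close> to the next one around, so one edge brings in all of them. Conversely,
  \<open>G\<close> itself is a cycle.\<close>

lemma cycle_edge_sets_cycle_graph:
  assumes "is_cycle_graph n G"
  shows "cycle_edge_sets G = {edges G}"
proof -
  obtain v f where c: "is_cycle G n v f" and E: "edges G = f ` {..<n}"
    using assms unfolding is_cycle_graph_def by blast
  have n: "2 \<le> n" and injv: "inj_on v {..<n}"
    and ends: "\<And>i. i < n \<Longrightarrow> ends G (f i) = {v i, v (Suc i mod n)}"
    using c by (auto simp: is_cycle_def)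
  have "g ` {..<k} = edges G" if c': "is_cycle G k w g" for k w g
  proof -
    let ?D = "g ` {..<k}"
    have D: "?D \<subseteq> edges G" and k: "2 \<le> k" using c' by (auto simp: is_cycle_def)
    have step: "f (Suc i mod n) \<in> ?D" if i: "i < n" "f i \<in> ?D" for i
    proof -
      have "v (Suc i mod n) \<in> ends G (f i)" using ends i by simp
      then obtain d' where d': "d' \<in> ?D" "d' \<noteq> f i" "v (Suc i mod n) \<in> ends G d'"
        using cycle_edge_adjacent[OF c' i(2)] by blast
      then obtain l where l: "l < n" "d' = f l" using D E by auto
      \<comment> \<open>The vertex between \<open>f i\<close> and its successor lies on no third
        edge of \<open>G\<close>. The case of equal successors is excluded because it would give
        \<open>l = i\<close>.\<close>
      have "v (Suc i mod n) = v l \<or> v (Suc i mod n) = v (Suc l mod n)"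
        using d'(3) l ends by auto
      then have "Suc i mod n = l \<or> Suc i mod n = Suc l mod n"
        using injv n l(1) by (auto simp: inj_on_def)
      moreover have "Suc i mod n \<noteq> Suc l mod n"
        using i(1) l d'(2) by (auto simp: mod_Suc split: if_splits)
      ultimately show ?thesis using d' l by auto
    qed
    have "g 0 \<in> edges G" using D k by auto
    then obtain i0 where i0: "i0 < n" "g 0 = f i0" using E by auto
    have "f ((i0 + j) mod n) \<in> ?D" for j
    proof (induction j)
      case 0
      have "g 0 \<in> ?D" using k by auto
      then show ?case using i0 by simp
    next
      case (Suc j)
      from step[OF _ this] n show ?case by (simp add: mod_Suc_eq)
    qed
    \<comment> \<open>Starting at \<open>i0\<close>, one reaches \<open>i\<close> after
      \<open>n - i0 + i\<close> steps; the extra \<open>n\<close> avoids the difference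
      \<open>i - i0\<close>, which might truncate.\<close>
    moreover have "i = (i0 + (n - i0 + i)) mod n" if "i < n" for i
      using that i0(1) by simp
    ultimately have "f i \<in> ?D" if "i < n" for i
      using that by metis
    then show ?thesis using D E by auto
  qed
  then show ?thesis
    unfolding cycle_edge_sets_def using c E by (intro equalityI subsetI) blast+
qed

lemma card_vertices_cycle_graph:
  assumes "is_cycle_graph n G"
  shows "card (vertices G) = n"
  using assms by (auto simp: is_cycle_graph_def is_cycle_def card_image)

text \<open>Monotonicity of \<open>e\<close> makes \<open>e n\<close> the largest edge of the only
  cycle.\<close>

lemma broken_circuits_cycle_graph:
  assumes "is_cycle_graph n G" "edges G = e ` {1..n}" "strict_mono_on {1..n} e"
  shows "broken_circuits G = {e ` {1..n-1}}"
proof -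
  have n: "2 \<le> n" using assms(1) by (auto simp: is_cycle_graph_def is_cycle_def)
  have inj: "inj_on e {1..n}" using assms(3) by (rule strict_mono_on_imp_inj_on)
  have "e i \<le> e n" if "i \<in> {1..n}" for i
    using strict_mono_on_leD[OF assms(3) that] that n by auto
  then have "Max (e ` {1..n}) = e n"
    using n by (intro Max_eqI) auto
  moreover have "e ` {1..n} - {e n} = e ` ({1..n} - {n})"
    using inj n by (subst inj_on_image_set_diff[of e "{1..n}"]) auto
  moreover have "{1..n} - {n} = {1..n-1}" using n by auto
  ultimately show ?thesis
    using assms by (simp add: broken_circuits_def cycle_edge_sets_cycle_graph)
qed

lemma h_poly_cycle_graph:
  assumes "is_cycle_graph n G" "edges G = e ` {1..n}" "strict_mono_on {1..n} e"
  shows "h_poly G = (\<Sum>i=0..n-2. [:0, 1:] ^ i)"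
proof -
  have n: "2 \<le> n" using assms(1) by (auto simp: is_cycle_graph_def is_cycle_def)
  define z :: "int poly" where "z = [:0, 1:]"
  define A where "A = e ` {1..n-1}"
  have inj: "inj_on e {1..n}" using assms(3) by (rule strict_mono_on_imp_inj_on)
  have cardE: "card (edges G) = n" using assms(2) inj by (simp add: card_image)
  have finE: "finite (edges G)" using assms(2) by simp
  have "inj_on e {1..n-1}" by (rule inj_on_subset[OF inj]) auto
  then have cardA: "card A = n - 1" by (simp add: A_def card_image)
  have AE: "A \<subseteq> edges G" using assms(2) by (auto simp: A_def)
  \<comment> \<open>A non-face must contain \<open>A\<close>. With at most
    \<open>n - 1 = card A\<close> elements it can only be \<open>A\<close> itself.\<close>
  have faces: "{F \<in> bc_complex G. card F = i} =
      {F. F \<subseteq> edges G \<and> card F = i} - (if i = n - 1 then {A} else {})" if "i \<le> n - 1" for i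
  proof -
    have "A \<subseteq> F \<longleftrightarrow> i = n - 1 \<and> F = A" if "F \<subseteq> edges G" "card F = i" for F
    proof -
      have "finite F" using that finE finite_subset by blast
      then show ?thesis
        using that \<open>i \<le> n - 1\<close> cardA card_mono[of F A] card_subset_eq[of F A] by auto
    qed
    then show ?thesis
      unfolding bc_complex_def broken_circuits_cycle_graph[OF assms] A_def[symmetric]
      by auto
  qed
  have fc: "int (face_count G i) = int (n choose i) - (if i = n - 1 then 1 else 0)" if "i \<le> n - 1" for i
  proof -
    have "card {F. F \<subseteq> edges G \<and> card F = i} = n choose i"
      using n_subsets[OF finE] cardE by simp
    moreover have "A \<in> {F. F \<subseteq> edges G \<and> card F = n - 1}" using AE cardA by simp
    \<comment> \<open>Removing \<open>A\<close> subtracts 1 from a natural number; this bound makes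
      the subtraction exact over the integers.\<close>
    moreover have "n choose (n - 1) \<ge> 1" using n by (simp add: Suc_leI)
    ultimately show ?thesis
      unfolding face_count_def faces[OF that] by (auto simp: card_Diff_singleton)
  qed
  have "h_poly G = (\<Sum>i=0..n-1. of_nat (face_count G i) * z ^ i * (1 - z) ^ (n - 1 - i))"
    unfolding h_poly_def card_vertices_cycle_graph[OF assms(1)] Let_def z_def ..
  \<comment> \<open>The missing face \<open>A\<close> has \<open>n - 1\<close> elements, where the
    factor \<open>(1 - z) ^ 0\<close> is 1, so it costs exactly \<open>z ^ (n - 1)\<close>.\<close>
  also have "\<dots> = (\<Sum>i=0..n-1. of_nat (n choose i) * z ^ i * (1 - z) ^ (n - 1 - i)
      - (if i = n - 1 then z ^ (n - 1) else 0))"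
  proof (rule sum.cong)
    fix i assume "i \<in> {0..n-1}"
    then have "(of_nat (face_count G i) :: int poly) = of_nat (n choose i) - (if i = n - 1 then 1 else 0)"
      using fc[of i, THEN arg_cong[of _ _ "of_int :: int \<Rightarrow> int poly"]] by (simp split: if_splits)
    then show "of_nat (face_count G i) * z ^ i * (1 - z) ^ (n - 1 - i) =
      of_nat (n choose i) * z ^ i * (1 - z) ^ (n - 1 - i) - (if i = n - 1 then z ^ (n - 1) else 0)"
      by (cases "i = n - 1") (simp_all add: left_diff_distrib)
  qed simp
  also have "\<dots> = (\<Sum>i=0..n-1. of_nat (n choose i) * z ^ i * (1 - z) ^ (n - 1 - i)) - z ^ (n - 1)"
    by (simp add: sum_subtractf)
  finally have h: "h_poly G = \<dots>" .
  \<comment> \<open>The factor \<open>1 - z\<close> raises each exponent \<open>n - 1 - i\<close> to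
    \<open>n - i\<close>, which gives the binomial expansion of \<open>(z + (1 - z)) ^ n = 1\<close>
    without its term \<open>i = n\<close>.\<close>
  have "(1 - z) * (\<Sum>i=0..n-1. of_nat (n choose i) * z ^ i * (1 - z) ^ (n - 1 - i))
      = (\<Sum>i=0..n-1. of_nat (n choose i) * z ^ i * (1 - z) ^ (n - i))"
    unfolding sum_distrib_left
  proof (rule sum.cong)
    fix i assume "i \<in> {0..n-1}"
    then have "n - i = Suc (n - 1 - i)" using n by auto
    then show "(1 - z) * (of_nat (n choose i) * z ^ i * (1 - z) ^ (n - 1 - i)) =
        of_nat (n choose i) * z ^ i * (1 - z) ^ (n - i)" by (simp add: mult_ac)
  qed simp
  also have "\<dots> = (z + (1 - z)) ^ n - z ^ n"
  proof -
    have "{..n} = insert n {0..n-1}" using n by auto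
    then show ?thesis using n unfolding binomial_ring by simp
  qed
  finally have "(1 - z) * h_poly G = 1 - z ^ n - (1 - z) * z ^ (n - 1)"
    unfolding h by (simp add: right_diff_distrib)
  also have "\<dots> = 1 - z ^ (n - 1)"
    using n by (cases n) (simp_all add: algebra_simps)
  also have "\<dots> = (1 - z) * (\<Sum>i=0..n-2. z ^ i)"
  proof -
    have "{0..n-2} = {..<n-1}" using n by auto
    then show ?thesis by (simp add: one_diff_power_eq)
  qed
  finally have "(1 - z) * h_poly G = (1 - z) * (\<Sum>i=0..n-2. z ^ i)" .
  moreover have "1 - z \<noteq> 0" by (simp add: z_def one_pCons)
  ultimately show ?thesis by (simp add: z_def)
qed

section \<open>Counting monomials\<close>

text \<open>The degree that \<open>hom_polys\<close> prescribes for each exponent vector of a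
  polynomial.\<close>

definition mdeg :: "('e \<Rightarrow>\<^sub>0 nat) \<Rightarrow> nat" where
  "mdeg m = (\<Sum>a\<in>Poly_Mapping.keys m. Poly_Mapping.lookup m a)"

definition monomials :: "'e set \<Rightarrow> nat \<Rightarrow> ('e \<Rightarrow>\<^sub>0 nat) set" where
  "monomials E d = {m. Poly_Mapping.keys m \<subseteq> E \<and> mdeg m = d}"

lemma mdeg_add: "mdeg (m + m') = mdeg m + mdeg m'"
  unfolding mdeg_def by (rule setsum_keys_plus_distrib) simp_all

lemma mdeg_zero [simp]: "mdeg 0 = 0"
  by (simp add: mdeg_def)

lemma mdeg_single [simp]: "mdeg (Poly_Mapping.single a k) = k"
  by (simp add: mdeg_def)

lemma mdeg_eq_zero_iff: "mdeg m = 0 \<longleftrightarrow> m = 0"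
  by (auto simp: mdeg_def in_keys_iff intro!: poly_mapping_eqI)

text \<open>Natural number exponents cannot cancel, so the general inclusion for keys of a sum
  becomes an equality.\<close>

lemma keys_add_nat:
  fixes m m' :: "'e \<Rightarrow>\<^sub>0 nat"
  shows "Poly_Mapping.keys (m + m') = Poly_Mapping.keys m \<union> Poly_Mapping.keys m'"
  by (auto simp: in_keys_iff lookup_add)

text \<open>Divisibility of monomials is encoded as translation of exponent vectors; this is the
  case of a single variable as divisor.\<close>

lemma multiples_single:
  fixes a :: 'e
  shows "range ((+) (Poly_Mapping.single a (1::nat))) = {m. a \<in> Poly_Mapping.keys m}"
proof (intro equalityI subsetI)
  fix m :: "'e \<Rightarrow>\<^sub>0 nat" assume m: "m \<in> {m. a \<in> Poly_Mapping.keys m}"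
  \<comment> \<open>The pointwise subtraction is exact, since \<open>a\<close> has exponent at least
    1 in \<open>m\<close>.\<close>
  have "m = Poly_Mapping.single a 1 + (m - Poly_Mapping.single a 1)"
    using m by (intro poly_mapping_eqI)
      (auto simp: lookup_add lookup_minus lookup_single in_keys_iff when_def)
  then show "m \<in> range ((+) (Poly_Mapping.single a 1))" by (rule range_eqI)
qed (auto simp: keys_add_nat)

lemma monomials_Int_multiples:
  assumes "Poly_Mapping.keys \<mu> \<subseteq> E"
  shows "monomials E d \<inter> range ((+) \<mu>) =
    (if d < mdeg \<mu> then {} else (+) \<mu> ` monomials E (d - mdeg \<mu>))"
  using assms by (auto simp: monomials_def mdeg_add keys_add_nat)

text \<open>Induction on the degree: a monomial of positive degree is one of finitely many variables
  times a monomial of degree one less.\<close>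

lemma finite_monomials:
  assumes "finite E"
  shows "finite (monomials E d)"
proof (induction d)
  case 0
  have "monomials E 0 \<subseteq> {0}"
    by (auto simp: monomials_def mdeg_eq_zero_iff)
  then show ?case by (rule finite_subset) simp
next
  case (Suc d)
  have "monomials E (Suc d) \<subseteq> (\<Union>a\<in>E. (+) (Poly_Mapping.single a 1) ` monomials E d)"
  proof
    fix m assume m: "m \<in> monomials E (Suc d)"
    then have "Poly_Mapping.keys m \<noteq> {}" by (auto simp: monomials_def mdeg_def)
    then obtain a where a: "a \<in> Poly_Mapping.keys m" by blast
    then have "a \<in> E" using m by (auto simp: monomials_def)
    moreover from a have "m \<in> monomials E (Suc d) \<inter> range ((+) (Poly_Mapping.single a 1))"
      using m by (subst multiples_single) simp
    ultimately show "m \<in> (\<Union>a\<in>E. (+) (Poly_Mapping.single a 1) ` monomials E d)"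
      by (subst (asm) monomials_Int_multiples) auto
  qed
  then show ?case by (rule finite_subset) (simp add: assms Suc)
qed

lemma fps_card_nonmultiples:
  assumes "finite E" "Poly_Mapping.keys \<mu> \<subseteq> E"
  shows "Abs_fps (\<lambda>d. of_nat (card (monomials E d - range ((+) \<mu>)))) =
    (1 - fps_X ^ mdeg \<mu>) * (Abs_fps (\<lambda>d. of_nat (card (monomials E d))) :: 'a::comm_ring_1 fps)"
proof (rule fps_ext)
  fix d
  have "card (monomials E d) =
      card (monomials E d - range ((+) \<mu>)) + card (monomials E d \<inter> range ((+) \<mu>))"
    by (subst card_Un_disjoint[symmetric])
      (auto simp: finite_monomials[OF assms(1)] intro: arg_cong[of _ _ card])
  \<comment> \<open>The two cases are the coefficients of the full series multiplied by
    \<open>fps_X ^ mdeg \<mu>\<close>: zero below degree \<open>mdeg \<mu>\<close>, shifted from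
    there on.\<close>
  moreover have "card (monomials E d \<inter> range ((+) \<mu>)) =
      (if d < mdeg \<mu> then 0 else card (monomials E (d - mdeg \<mu>)))"
    using assms by (simp add: monomials_Int_multiples card_image)
  ultimately show "fps_nth (Abs_fps (\<lambda>d. of_nat (card (monomials E d - range ((+) \<mu>))))) d =
      fps_nth ((1 - fps_X ^ mdeg \<mu>) * (Abs_fps (\<lambda>d. of_nat (card (monomials E d))) :: 'a fps)) d"
    by (auto simp: left_diff_distrib fps_X_power_mult_nth)
qed

text \<open>Monomials in the old variables are those in the enlarged set not divisible by the new
  variable, so each new variable is compensated by one factor \<open>1 - fps_X\<close>.\<close>

lemma fps_card_monomials:
  fixes E :: "'e set"
  assumes "finite E"
  shows "(1 - fps_X) ^ card E *
    (Abs_fps (\<lambda>d. of_nat (card (monomials E d))) :: 'a::comm_ring_1 fps) = 1"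
  using assms
proof (induction E rule: finite_induct)
  case empty
  have "monomials ({} :: 'e set) d = (if d = 0 then {0} else {})" for d :: nat
    by (auto simp: monomials_def)
  then show ?case by (auto simp: fps_eq_iff)
next
  case (insert a E)
  have "monomials E d = monomials (insert a E) d - range ((+) (Poly_Mapping.single a 1))" for d
    using insert.hyps unfolding multiples_single by (auto simp: monomials_def)
  then have "(Abs_fps (\<lambda>d. of_nat (card (monomials E d))) :: 'a fps) =
      (1 - fps_X) * Abs_fps (\<lambda>d. of_nat (card (monomials (insert a E) d)))"
    using fps_card_nonmultiples[of "insert a E" "Poly_Mapping.single a 1"] insert.hyps by simp
  with insert show ?case by (simp add: mult_ac)
qed

section \<open>Quotients by monomial ideals\<close>

lemma sum_single_lookup: "(\<Sum>m\<in>Poly_Mapping.keys p. Poly_Mapping.single m (Poly_Mapping.lookup p m)) = p"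
  by (intro poly_mapping_eqI)
    (simp add: lookup_sum lookup_single when_def in_keys_iff sum.delta[where S="Poly_Mapping.keys p"])

text \<open>Serves twice: with \<open>{m}\<close> it isolates one term, and with the monomials of an
  ideal it splits off the part that vanishes in the quotient.\<close>

lemma restrict_poly_mapping:
  obtains q r where "p = q + r" "Poly_Mapping.keys q = Poly_Mapping.keys p \<inter> T"
    "Poly_Mapping.keys r = Poly_Mapping.keys p - T"
proof -
  let ?q = "Poly_Mapping.mapp (\<lambda>m c. c when m \<in> T) p"
  let ?r = "Poly_Mapping.mapp (\<lambda>m c. c when m \<notin> T) p"
  have "p = ?q + ?r"
    by (intro poly_mapping_eqI) (auto simp: lookup_add lookup_mapp when_def in_keys_iff)
  moreover have "Poly_Mapping.keys ?q = Poly_Mapping.keys p \<inter> T" "Poly_Mapping.keys ?r = Poly_Mapping.keys p - T"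
    by (auto simp: in_keys_iff lookup_mapp when_def split: if_splits)
  ultimately show thesis by (rule that)
qed

lemma poly_ring_simps:
  "carrier (poly_ring E) = {p. \<forall>m\<in>Poly_Mapping.keys p. Poly_Mapping.keys m \<subseteq> E}"
  "x \<otimes>\<^bsub>poly_ring E\<^esub> y = x * y" "x \<oplus>\<^bsub>poly_ring E\<^esub> y = x + y"
  "\<one>\<^bsub>poly_ring E\<^esub> = 1" "\<zero>\<^bsub>poly_ring E\<^esub> = 0"
  by (simp_all add: poly_ring_def)

lemma prod_Var:
  "finite A \<Longrightarrow> (\<Prod>a\<in>A. Var a) = Poly_Mapping.single (\<Sum>a\<in>A. Poly_Mapping.single a 1) 1"
  by (induction A rule: finite_induct) (simp_all add: Var_def mult_single)

lemma keys_sum_single_one: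
  "finite A \<Longrightarrow> Poly_Mapping.keys (\<Sum>a\<in>A. Poly_Mapping.single a (1::nat)) = A"
  by (induction A rule: finite_induct) (simp_all add: keys_add_nat)

lemma mdeg_sum_single_one: "finite A \<Longrightarrow> mdeg (\<Sum>a\<in>A. Poly_Mapping.single a (1::nat)) = card A"
  by (induction A rule: finite_induct) (simp_all add: mdeg_add)

text \<open>Divisibility of a polynomial by a monomial can be tested term by term, because each term
  can be divided separately.\<close>

lemma genideal_monomial:
  fixes \<mu> :: "'e \<Rightarrow>\<^sub>0 nat"
  assumes "Poly_Mapping.keys \<mu> \<subseteq> E"
  shows "Idl\<^bsub>poly_ring E\<^esub> {Poly_Mapping.single \<mu> (1::'k::field)} =
    {p \<in> carrier (poly_ring E). Poly_Mapping.keys p \<subseteq> range ((+) \<mu>)}"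
proof -
  interpret cring "poly_ring E :: ('e, 'k) mpoly ring" by (rule poly_ring_cring)
  let ?x = "Poly_Mapping.single \<mu> (1::'k)"
  have x: "?x \<in> carrier (poly_ring E)" using assms by (simp add: poly_ring_simps)
  have "(\<exists>r. p = r * ?x \<and> r \<in> carrier (poly_ring E)) \<longleftrightarrow>
      p \<in> carrier (poly_ring E) \<and> Poly_Mapping.keys p \<subseteq> range ((+) \<mu>)" for p
  proof (intro iffI)
    assume "\<exists>r. p = r * ?x \<and> r \<in> carrier (poly_ring E)"
    then obtain r where r: "p = r * ?x" "r \<in> carrier (poly_ring E)" by blast
    then have "p \<in> carrier (poly_ring E)" using m_closed[OF r(2) x] by (simp add: poly_ring_simps)
    moreover have "Poly_Mapping.keys p \<subseteq> range ((+) \<mu>)"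
      using keys_mult[of r ?x] unfolding r(1) by (auto simp: add.commute)
    ultimately show "p \<in> carrier (poly_ring E) \<and> Poly_Mapping.keys p \<subseteq> range ((+) \<mu>)" ..
  next
    assume p: "p \<in> carrier (poly_ring E) \<and> Poly_Mapping.keys p \<subseteq> range ((+) \<mu>)"
    \<comment> \<open>The quotient of \<open>p\<close> by \<open>x ^ \<mu>\<close>; the subtraction
      \<open>m - \<mu>\<close> is exact because every \<open>m\<close> here is a multiple of
      \<open>\<mu>\<close>.\<close>
    define r where "r = (\<Sum>m\<in>Poly_Mapping.keys p. Poly_Mapping.single (m - \<mu>) (Poly_Mapping.lookup p m))"
    have "r * ?x = (\<Sum>m\<in>Poly_Mapping.keys p. Poly_Mapping.single m (Poly_Mapping.lookup p m))"
      unfolding r_def sum_distrib_right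
      by (rule sum.cong) (use p in \<open>auto simp: mult_single add.commute\<close>)
    then have "p = r * ?x" by (simp add: sum_single_lookup)
    moreover have "r \<in> carrier (poly_ring E)"
    proof -
      have "Poly_Mapping.keys r \<subseteq> (\<lambda>m. m - \<mu>) ` Poly_Mapping.keys p"
        unfolding r_def by (rule order_trans[OF Poly_Mapping.keys_sum]) auto
      moreover have "Poly_Mapping.keys (m - \<mu>) \<subseteq> Poly_Mapping.keys m" for m :: "'e \<Rightarrow>\<^sub>0 nat"
        by (auto simp: in_keys_iff lookup_minus)
      ultimately show ?thesis using p unfolding poly_ring_simps by blast
    qed
    ultimately show "\<exists>r. p = r * ?x \<and> r \<in> carrier (poly_ring E)" by blast
  qed
  then show ?thesis
    unfolding cgenideal_eq_genideal[OF x, symmetric] cgenideal_def poly_ring_simps(2) by blast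
qed

text \<open>The dimensions in \<open>hilbert_series\<close> are taken over a field inside the ring;
  the constants are that field before passing to the quotient.\<close>

lemma subfield_range_Const: "subfield (range Const) (poly_ring E :: ('e, 'k::field) mpoly ring)"
proof -
  interpret R: cring "poly_ring E :: ('e, 'k) mpoly ring" by (rule poly_ring_cring)
  have carr: "range Const \<subseteq> carrier (poly_ring E :: ('e, 'k) mpoly ring)"
    by (auto simp: poly_ring_simps Const_def split: if_splits)
  have neg: "\<ominus>\<^bsub>poly_ring E\<^esub> Const c = Const (- c)" for c :: 'k
    using carr by (intro R.minus_equality) (auto simp: poly_ring_simps Const_def single_add[symmetric])
  have "subring (range Const) (poly_ring E :: ('e, 'k) mpoly ring)"
  proof (rule R.subringI[OF carr])
    show "\<one>\<^bsub>poly_ring E\<^esub> \<in> range (Const :: 'k \<Rightarrow> ('e, 'k) mpoly)"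
      by (auto simp: poly_ring_simps Const_def intro!: range_eqI[of _ _ 1])
  next
    fix h :: "('e, 'k) mpoly" assume "h \<in> range Const"
    then show "\<ominus>\<^bsub>poly_ring E\<^esub> h \<in> range Const" using neg by auto
  next
    fix h1 h2 :: "('e, 'k) mpoly" assume "h1 \<in> range Const" "h2 \<in> range Const"
    then obtain a b where "h1 = Const a" "h2 = Const b" by blast
    then have "h1 * h2 = Const (a * b)" "h1 + h2 = Const (a + b)"
      by (simp_all add: Const_def mult_single single_add)
    then show "h1 \<otimes>\<^bsub>poly_ring E\<^esub> h2 \<in> range Const" "h1 \<oplus>\<^bsub>poly_ring E\<^esub> h2 \<in> range Const"
      by (auto simp: poly_ring_simps)
  qed
  then have "subcring (range Const) (poly_ring E :: ('e, 'k) mpoly ring)"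
    using carr by (intro R.subcringI) (auto intro: R.m_comm)
  moreover have "Units ((poly_ring E :: ('e, 'k) mpoly ring)\<lparr>carrier := range Const\<rparr>) =
      range Const - {\<zero>\<^bsub>poly_ring E\<^esub>}"
  proof (intro equalityI subsetI)
    fix x :: "('e, 'k) mpoly" assume "x \<in> range Const - {\<zero>\<^bsub>poly_ring E\<^esub>}"
    then obtain c where c: "x = Const c" "c \<noteq> 0"
      by (auto simp: poly_ring_simps Const_def) (metis single_zero)
    then have "x * Const (inverse c) = 1" "Const (inverse c) * x = 1"
      by (simp_all add: Const_def mult_single)
    with c show "x \<in> Units ((poly_ring E)\<lparr>carrier := range Const\<rparr>)"
      by (auto simp: Units_def poly_ring_simps)
  next
    fix x :: "('e, 'k) mpoly" assume "x \<in> Units ((poly_ring E)\<lparr>carrier := range Const\<rparr>)"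
    then show "x \<in> range Const - {\<zero>\<^bsub>poly_ring E\<^esub>}"
      by (auto simp: Units_def poly_ring_simps)
  qed
  ultimately show ?thesis by (rule R.subfieldI)
qed

text \<open>The residues of the monomials of degree \<open>d\<close> outside \<open>T\<close> form a
  basis. The condition \<open>0 \<notin> T\<close> keeps 1 out of \<open>I\<close>, so that the
  quotient is nonzero and the constants still form a field in it.\<close>

lemma dim_monomial_quotient:
  fixes I :: "('e, 'k::field) mpoly set"
  assumes I: "ideal I (poly_ring E)"
    and I_eq: "I = {p \<in> carrier (poly_ring E). Poly_Mapping.keys p \<subseteq> T}"
    and T: "0 \<notin> T" and E: "finite E"
  shows "ring.dim (poly_ring E Quot I) ((+>\<^bsub>poly_ring E\<^esub>) I ` range Const)
    ((+>\<^bsub>poly_ring E\<^esub>) I ` hom_polys E d) = card (monomials E d - T)"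
proof -
  let ?P = "poly_ring E :: ('e, 'k) mpoly ring"
  let ?Q = "?P Quot I"
  let ?res = "(+>\<^bsub>?P\<^esub>) I"
  have zero_Q: "\<zero>\<^bsub>?Q\<^esub> = I" by (simp add: FactRing_def)
  interpret I: ideal I ?P by (rule I)
  interpret h: ring_hom_ring ?P ?Q ?res by (rule I.rcos_ring_hom_ring)
  let ?K = "?res ` range Const"
  let ?V = "\<lambda>S. {p :: ('e, 'k) mpoly. Poly_Mapping.keys p \<subseteq> S}"
  have res_0: "?res p = \<zero>\<^bsub>?Q\<^esub>" if "p \<in> I" for p
    using that unfolding zero_Q by (rule I.a_rcos_zero[OF I])
  have res_add: "?res (p + q) = ?res p \<oplus>\<^bsub>?Q\<^esub> ?res q" if "p \<in> carrier ?P" "q \<in> carrier ?P" for p q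
    using h.hom_add[OF that] by (simp add: poly_ring_simps)
  have res_mult: "?res (p * q) = ?res p \<otimes>\<^bsub>?Q\<^esub> ?res q" if "p \<in> carrier ?P" "q \<in> carrier ?P" for p q
    using h.hom_mult[OF that] by (simp add: poly_ring_simps)
  have res_eqD: "p - q \<in> I" if "p \<in> carrier ?P" "?res p = ?res q" for p q
  proof -
    have "p \<in> ?res q" using I.a_rcos_self[OF that(1)] that(2) by simp
    then obtain i where "i \<in> I" "p = i + q" by (auto simp: a_r_coset_def' poly_ring_simps)
    then show ?thesis by simp
  qed
  have Const: "Const c \<in> carrier ?P" for c by (simp add: poly_ring_simps Const_def)
  have "\<one>\<^bsub>?P\<^esub> \<notin> I" unfolding poly_ring_simps I_eq using T by simp
  then have "?res \<one>\<^bsub>?P\<^esub> \<noteq> \<zero>\<^bsub>?Q\<^esub>"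
    unfolding zero_Q using I.rcos_const_imp_mem[OF I.one_closed] by blast
  then have "\<one>\<^bsub>?Q\<^esub> \<noteq> \<zero>\<^bsub>?Q\<^esub>" unfolding h.hom_one .
  then have K: "subfield ?K ?Q"
    by (rule h.img_is_subfield(2)[OF subfield_range_Const])
  \<comment> \<open>Induction over a finite set of monomials outside \<open>T\<close>: each new one
    is independent of the previous ones modulo \<open>I\<close> and adds one dimension.\<close>
  have dim_V: "h.S.dimension (card S) ?K (?res ` ?V S)"
    if "finite S" "S \<inter> T = {}" "\<forall>m\<in>S. Poly_Mapping.keys m \<subseteq> E" for S
    using that
  proof (induction S rule: finite_induct)
    case empty
    have "?res ` ?V {} = {\<zero>\<^bsub>?Q\<^esub>}" using res_0[of 0] by (auto simp: I_eq poly_ring_simps)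
    then show ?case by simp
  next
    case (insert m S)
    let ?x = "Poly_Mapping.single m (1::'k)"
    have x: "?x \<in> carrier ?P" using insert.prems by (simp add: poly_ring_simps)
    have VS: "?V S \<subseteq> carrier ?P" using insert.prems by (auto simp: poly_ring_simps)
    have "?res ?x \<notin> ?res ` ?V S"
    proof
      assume "?res ?x \<in> ?res ` ?V S"
      then obtain q where q: "q \<in> ?V S" "?res ?x = ?res q" by blast
      then have "?x - q \<in> I" using x by (intro res_eqD) auto
      \<comment> \<open>As \<open>q\<close> has no term at \<open>m\<close>, the coefficient of
        \<open>?x - q\<close> there is 1, and membership in \<open>I\<close> would put
        \<open>m\<close> into \<open>T\<close>.\<close>
      moreover have "Poly_Mapping.lookup q m = 0"
        using q(1) insert.hyps(2) by (auto simp: not_in_keys_iff_lookup_eq_zero[symmetric])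
      then have "m \<in> Poly_Mapping.keys (?x - q)" by (simp add: in_keys_iff lookup_minus)
      ultimately have "m \<in> T" using I_eq by blast
      with insert.prems show False by blast
    qed
    moreover have "?res ` ?V (insert m S) = h.S.line_extension ?K (?res ?x) (?res ` ?V S)"
    proof -
      have V_insert: "?V (insert m S) = {Const c * ?x + q |c q. q \<in> ?V S}"
      proof (intro equalityI subsetI)
        fix p assume p: "p \<in> ?V (insert m S)"
        obtain q r where pqr: "p = q + r" "Poly_Mapping.keys q = Poly_Mapping.keys p \<inter> {m}"
          "Poly_Mapping.keys r = Poly_Mapping.keys p - {m}"
          by (rule restrict_poly_mapping[of p "{m}"])
        have "q = Const (Poly_Mapping.lookup q m) * ?x"
          using pqr(2) by (intro poly_mapping_eqI)
            (auto simp: Const_def mult_single lookup_single when_def in_keys_iff)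
        then obtain c where "q = Const c * ?x" by blast
        with pqr(1) have "p = Const c * ?x + r" by simp
        moreover have "r \<in> ?V S" using p pqr(3) by auto
        ultimately show "p \<in> {Const c * ?x + q |c q. q \<in> ?V S}" by blast
      next
        fix p assume "p \<in> {Const c * ?x + q |c q. q \<in> ?V S}"
        then obtain c q where "p = Poly_Mapping.single m c + q" "q \<in> ?V S"
          by (auto simp: Const_def mult_single)
        then show "p \<in> ?V (insert m S)"
          using Poly_Mapping.keys_add[of "Poly_Mapping.single m c" q] by (auto split: if_splits)
      qed
      have res_comb: "?res (Const c * ?x + q) = ?res (Const c) \<otimes>\<^bsub>?Q\<^esub> ?res ?x \<oplus>\<^bsub>?Q\<^esub> ?res q"
        if "q \<in> ?V S" for c q
      proof -
        have "Const c * ?x \<in> carrier ?P" using I.m_closed[OF Const x] by (simp add: poly_ring_simps)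
        then show ?thesis using that VS by (subst res_add) (auto simp: res_mult[OF Const x])
      qed
      show ?thesis
      proof (rule Set.set_eqI)
        fix y
        have "y \<in> ?res ` ?V (insert m S) \<longleftrightarrow> (\<exists>c. \<exists>q\<in>?V S. y = ?res (Const c * ?x + q))"
          unfolding V_insert by blast
        also have "\<dots> \<longleftrightarrow> (\<exists>c. \<exists>q\<in>?V S. y = ?res (Const c) \<otimes>\<^bsub>?Q\<^esub> ?res ?x \<oplus>\<^bsub>?Q\<^esub> ?res q)"
          by (intro ex_cong1 bex_cong refl) (simp only: res_comb)
        also have "\<dots> \<longleftrightarrow> y \<in> h.S.line_extension ?K (?res ?x) (?res ` ?V S)"
          unfolding h.S.line_extension_mem_iff by blast
        finally show "y \<in> ?res ` ?V (insert m S) \<longleftrightarrow>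
            y \<in> h.S.line_extension ?K (?res ?x) (?res ` ?V S)" .
      qed
    qed
    moreover have "h.S.dimension (card S) ?K (?res ` ?V S)" using insert.IH insert.prems by blast
    ultimately have "h.S.dimension (Suc (card S)) ?K (?res ` ?V (insert m S))"
      using h.S.dimension.Suc_dim[OF h.hom_closed[OF x]] by presburger
    then show ?case using insert.hyps by simp
  qed
  \<comment> \<open>The terms with exponents in \<open>T\<close> add up to a member of
    \<open>I\<close> and vanish in the quotient; only the others remain.\<close>
  have "?res ` hom_polys E d = ?res ` ?V (monomials E d - T)"
  proof (intro equalityI image_subsetI)
    fix p :: "('e, 'k) mpoly" assume p: "p \<in> hom_polys E d"
    then have pm: "Poly_Mapping.keys p \<subseteq> monomials E d"
      by (auto simp: hom_polys_def poly_ring_simps monomials_def mdeg_def)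
    obtain q r where pqr: "p = q + r" "Poly_Mapping.keys q = Poly_Mapping.keys p \<inter> T"
      "Poly_Mapping.keys r = Poly_Mapping.keys p - T"
      by (rule restrict_poly_mapping[of p T])
    have r: "r \<in> carrier ?P" and q: "q \<in> I"
      using pm pqr I_eq by (auto simp: poly_ring_simps monomials_def)
    then have "?res p = ?res r"
      using pqr(1) h.hom_closed by (simp add: res_add[OF I.Icarr] res_0)
    moreover have "r \<in> ?V (monomials E d - T)" using pm pqr(3) by auto
    ultimately show "?res p \<in> ?res ` ?V (monomials E d - T)" by blast
  next
    fix p :: "('e, 'k) mpoly" assume "p \<in> ?V (monomials E d - T)"
    then have "p \<in> hom_polys E d" by (auto simp: hom_polys_def poly_ring_simps monomials_def mdeg_def)
    then show "?res p \<in> ?res ` hom_polys E d" by blast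
  qed
  moreover have "h.S.dimension (card (monomials E d - T)) ?K (?res ` ?V (monomials E d - T))"
    using finite_monomials[OF E] by (intro dim_V) (auto simp: monomials_def)
  \<comment> \<open>Over a field the relation \<open>dimension\<close> determines the value of
    \<open>dim\<close>.\<close>
  ultimately show ?thesis using h.S.dimI[OF K, unfolded over_def] by metis
qed

section \<open>The Stanley--Reisner ring of a cycle graph\<close>

lemma bc_ideal_cycle_graph:
  assumes "is_cycle_graph n G" "edges G = e ` {1..n}" "strict_mono_on {1..n} e"
  shows "(bc_ideal G :: ('e::linorder, 'k::field) mpoly set) =
    Idl\<^bsub>poly_ring (e ` {1..n})\<^esub> {\<Prod>a\<in>e ` {1..n-1}. Var a}"
  unfolding bc_ideal_def broken_circuits_cycle_graph[OF assms] assms(2) by simp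

lemma hilbert_series_cycle_graph:
  fixes G :: "('v, 'e::linorder) multigraph"
  assumes "is_cycle_graph n G" "edges G = e ` {1..n}" "strict_mono_on {1..n} e"
  shows "hilbert_series (bc_ring G :: ('e, 'k::field) mpoly set ring) (bc_scalars G) (bc_component G) =
    (\<Sum>i=0..n-2. fps_X ^ i) / (1 - fps_X) ^ (n - 1)"
proof -
  have n: "2 \<le> n" using assms(1) by (auto simp: is_cycle_graph_def is_cycle_def)
  define E where "E = e ` {1..n}"
  define A where "A = e ` {1..n-1}"
  define \<mu> where "\<mu> = (\<Sum>a\<in>A. Poly_Mapping.single a (1::nat))"
  have inj: "inj_on e {1..n}" using assms(3) by (rule strict_mono_on_imp_inj_on)
  then have "inj_on e {1..n-1}" by (rule inj_on_subset) auto
  then have cards: "card E = n" "card A = n - 1"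
    using inj by (simp_all add: E_def A_def card_image)
  have finE: "finite E" and finA: "finite A" by (simp_all add: E_def A_def)
  have keys_\<mu>: "Poly_Mapping.keys \<mu> = A" and deg_\<mu>: "mdeg \<mu> = n - 1"
    using finA cards by (simp_all only: \<mu>_def keys_sum_single_one mdeg_sum_single_one)
  have \<mu>E: "Poly_Mapping.keys \<mu> \<subseteq> E" unfolding keys_\<mu> by (auto simp: A_def E_def)
  let ?I = "bc_ideal G :: ('e, 'k) mpoly set"
  \<comment> \<open>The product of the variables in \<open>A\<close> is the single monomial
    \<open>x ^ \<mu>\<close>, so the results on monomial ideals apply.\<close>
  have I: "?I = Idl\<^bsub>poly_ring E\<^esub> {Poly_Mapping.single \<mu> 1}"
    unfolding bc_ideal_cycle_graph[OF assms] A_def[symmetric] E_def \<mu>_def prod_Var[OF finA] ..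
  have "ideal ?I (poly_ring E)"
    unfolding I using \<mu>E
    by (intro ring.genideal_ideal cring.axioms(1)[OF poly_ring_cring]) (simp add: poly_ring_simps)
  \<comment> \<open>The generator has degree \<open>n - 1 > 0\<close>, so 1 is not among its
    monomial multiples.\<close>
  moreover have "0 \<notin> range ((+) \<mu>)"
  proof
    assume "0 \<in> range ((+) \<mu>)"
    then obtain m where "0 = \<mu> + m" by blast
    then have "0 = mdeg \<mu> + mdeg m" using mdeg_add[of \<mu> m] by simp
    then show False using deg_\<mu> n by simp
  qed
  ultimately have "ring.dim (poly_ring E Quot ?I) ((+>\<^bsub>poly_ring E\<^esub>) ?I ` range Const)
      ((+>\<^bsub>poly_ring E\<^esub>) ?I ` hom_polys E d) = card (monomials E d - range ((+) \<mu>))" for d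
    using genideal_monomial[OF \<mu>E] finE by (intro dim_monomial_quotient) (simp_all add: I)
  moreover have "bc_residue G = (+>\<^bsub>poly_ring E\<^esub>) ?I"
    by (simp add: fun_eq_iff bc_residue_def assms(2) E_def)
  ultimately have "hilbert_series (bc_ring G :: ('e, 'k) mpoly set ring) (bc_scalars G) (bc_component G) =
      Abs_fps (\<lambda>d. of_nat (card (monomials E d - range ((+) \<mu>))))" (is "?H = _")
    unfolding hilbert_series_def bc_ring_def bc_scalars_def bc_component_def assms(2) E_def[symmetric]
    by simp
  also have "\<dots> = (1 - fps_X ^ (n - 1)) * Abs_fps (\<lambda>d. of_nat (card (monomials E d)))"
    using fps_card_nonmultiples[OF finE \<mu>E] deg_\<mu> by simp
  \<comment> \<open>Multiplication by \<open>(1 - fps_X) ^ n\<close> turns the series of all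
    monomials into 1. Cancelling one factor \<open>1 - fps_X\<close> below leaves the exponent
    \<open>n - 1\<close> of the denominator.\<close>
  finally have "(1 - fps_X) ^ n * ?H = 1 - fps_X ^ (n - 1)"
    using fps_card_monomials[OF finE, where ?'a = rat] cards(1) by (simp add: mult_ac)
  also have "\<dots> = (1 - fps_X) * (\<Sum>i=0..n-2. fps_X ^ i)"
  proof -
    have "{0..n-2} = {..<n-1}" using n by auto
    then show ?thesis by (simp add: one_diff_power_eq)
  qed
  also have "(1 - fps_X) ^ n = (1 - fps_X) * (1 - fps_X :: rat fps) ^ (n - 1)"
    using n by (simp add: power_eq_if)
  finally have "(1 - fps_X) * (?H * (1 - fps_X) ^ (n - 1)) = (1 - fps_X) * (\<Sum>i=0..n-2. fps_X ^ i)"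
    by (simp add: mult_ac)
  moreover have nz: "1 - fps_X \<noteq> (0 :: rat fps)"
    by (auto dest: arg_cong[of _ _ "\<lambda>f. fps_nth f 0"])
  ultimately have "?H * (1 - fps_X) ^ (n - 1) = (\<Sum>i=0..n-2. fps_X ^ i)" by simp
  then show ?thesis using nz by (metis nonzero_mult_div_cancel_right power_not_zero)
qed

theorem theorem6p1:
  fixes G :: "('v, 'e::linorder) multigraph"
    and e :: "nat \<Rightarrow> 'e"
    and n :: nat
  assumes "n \<ge> 3"
    and "is_cycle_graph n G"
    and "edges G = e ` {1..n}"
    and "strict_mono_on {1..n} e"
  shows "(bc_ideal G :: ('e, 'k::field) mpoly set) =
           Idl\<^bsub>poly_ring (e ` {1..n})\<^esub> {\<Prod>i=1..n-1. Var (e i)} \<and>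
         (bc_ring G :: ('e, 'k) mpoly set ring) =
           poly_ring (e ` {1..n}) Quot (Idl\<^bsub>poly_ring (e ` {1..n})\<^esub> {\<Prod>i=1..n-1. Var (e i)}) \<and>
         h_poly G = (\<Sum>i=0..n-2. [:0, 1:] ^ i) \<and>
         hilbert_series (bc_ring G :: ('e, 'k) mpoly set ring) (bc_scalars G) (bc_component G) =
           (\<Sum>i=0..n-2. fps_X ^ i) / (1 - fps_X) ^ (n - 1)"
proof -
  note G = assms(2-4)
  \<comment> \<open>Injectivity lets the product over the set of edges be rewritten as a product
    over indices without losing factors.\<close>
  have "inj_on e {1..n-1}"
    by (rule inj_on_subset[OF strict_mono_on_imp_inj_on[OF assms(4)]]) auto
  then have "(\<Prod>a\<in>e ` {1..n-1}. Var a) = (\<Prod>i=1..n-1. Var (e i) :: ('e, 'k) mpoly)"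
    by (simp add: prod.reindex)
  then have I: "(bc_ideal G :: ('e, 'k) mpoly set) =
      Idl\<^bsub>poly_ring (e ` {1..n})\<^esub> {\<Prod>i=1..n-1. Var (e i)}"
    using bc_ideal_cycle_graph[OF G] by metis
  moreover have "(bc_ring G :: ('e, 'k) mpoly set ring) =
      poly_ring (e ` {1..n}) Quot (Idl\<^bsub>poly_ring (e ` {1..n})\<^esub> {\<Prod>i=1..n-1. Var (e i)})"
    unfolding bc_ring_def I assms(3) ..
  ultimately show ?thesis
    using h_poly_cycle_graph[OF G] hilbert_series_cycle_graph[OF G] by blast
qed

end
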